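(* $a_{3, 2}\le \frac{1}{\sqrt{2}}$.
   Context: Let $H_{n,3}=\{0,1,\dots,n-1\}^3$. A $2$-rook is a point $P\in H_{n,3}$ together with a set $D$ of $2$ of the $3$ coordinate indices; it covers $P$ itself and every point of $H_{n,3}$ which differs from $P$ in exactly one coordinate, that coordinate belonging to $D$. Distinct rooks must occupy distinct points. $a_{n,3,2}$ is the minimum number of $2$-rooks whose covered sets together cover $H_{n,3}$, and $a_{3,2}=\lim_{n\to\infty} a_{n,3,2}/n^{2}$ (this limit exists). *)

theory Defs
  imports "HOL-Analysis.Analysis"
begin

type_synonym point = "3 \<Rightarrow> nat"

type_synonym rook = "point \<times> 3 set"

definition cube :: "nat \<Rightarrow> point set" where
  "cube n = {P. \<forall>i. P i < n}"

definition rooks :: "nat \<Rightarrow> rook set" where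
  "rooks n = cube n \<times> {D. card D = 2}"

definition covered :: "nat \<Rightarrow> rook \<Rightarrow> point set" where
  "covered n = (\<lambda>(P, D). {Q \<in> cube n. Q = P \<or> (\<exists>i\<in>D. {j. Q j \<noteq> P j} = {i})})"

(* Injectivity of fst on R says that distinct rooks occupy distinct points. *)
definition rook_covering :: "nat \<Rightarrow> rook set \<Rightarrow> bool" where
  "rook_covering n R \<longleftrightarrow>
     R \<subseteq> rooks n \<and> inj_on fst R \<and> (\<Union>r\<in>R. covered n r) = cube n"

definition a_num :: "nat \<Rightarrow> nat" where
  "a_num n = (LEAST m. \<exists>R. rook_covering n R \<and> card R = m)"

definition a_lim :: real where
  "a_lim = lim (\<lambda>n. real (a_num n) / real n ^ 2)"

(* The rest of the theory shows that the minimum and the limit above exist. *)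

lemma finite_cube: "finite (cube n)"
proof -
  have "cube n = (UNIV :: 3 set) \<rightarrow>\<^sub>E {..<n}"
    by (auto simp: cube_def PiE_def extensional_def)
  then show ?thesis by (simp add: finite_PiE)
qed

lemma rook_covering_finite:
  assumes "rook_covering n R"
  shows "finite R"
proof -
  have "finite (rooks n)"
    unfolding rooks_def by (intro finite_cartesian_product finite_cube) simp
  then show ?thesis
    using assms unfolding rook_covering_def by (meson finite_subset)
qed

lemma rook_coveringI:
  assumes "R \<subseteq> rooks n" "inj_on fst R"
    and "\<And>Q. Q \<in> cube n \<Longrightarrow> \<exists>P D. (P, D) \<in> R \<and> (Q = P \<or> (\<exists>i\<in>D. {j. Q j \<noteq> P j} = {i}))"
  shows "rook_covering n R"
  unfolding rook_covering_def
proof (intro conjI equalityI subsetI)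
  fix Q assume "Q \<in> (\<Union>r\<in>R. covered n r)"
  then show "Q \<in> cube n" by (auto simp: covered_def)
next
  fix Q assume Q: "Q \<in> cube n"
  from assms(3)[OF Q] obtain P D
    where "(P, D) \<in> R" "Q = P \<or> (\<exists>i\<in>D. {j. Q j \<noteq> P j} = {i})" by blast
  then have "Q \<in> covered n (P, D)" using Q by (simp add: covered_def)
  then show "Q \<in> (\<Union>r\<in>R. covered n r)" using \<open>(P, D) \<in> R\<close> by blast
qed (use assms in auto)

lemma rook_coveringD:
  assumes "rook_covering n R" "Q \<in> cube n"
  obtains P D where "(P, D) \<in> R" "P \<in> cube n" "card D = 2"
    "Q = P \<or> (\<exists>i\<in>D. {j. Q j \<noteq> P j} = {i})"
proof -
  have "Q \<in> (\<Union>r\<in>R. covered n r)" using assms by (simp add: rook_covering_def)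
  then obtain r where r: "r \<in> R" "Q \<in> covered n r" by blast
  obtain P D where PD: "r = (P, D)" by (cases r)
  have "r \<in> rooks n" using r(1) assms(1) by (auto simp: rook_covering_def)
  then show ?thesis using that[of P D] r PD by (auto simp: covered_def rooks_def)
qed

lemma card_Compl_singleton_3: "card (- {i :: 3}) = 2"
  by (simp add: Compl_eq_Diff_UNIV card_Diff_singleton)

lemma rook_covering_exists: "\<exists>R. rook_covering n R"
proof -
  have "rook_covering n ((\<lambda>P. (P, - {0})) ` cube n)"
    by (rule rook_coveringI)
      (auto simp: rooks_def card_Compl_singleton_3 inj_on_def)
  then show ?thesis by blast
qed

lemma a_num_attained: "\<exists>R. rook_covering n R \<and> card R = a_num n"
proof -
  have "\<exists>m. \<exists>R. rook_covering n R \<and> card R = m"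
    using rook_covering_exists by blast
  then show ?thesis unfolding a_num_def by (rule LeastI_ex)
qed

lemma a_num_le: "rook_covering n R \<Longrightarrow> a_num n \<le> card R"
  unfolding a_num_def by (rule Least_le) blast

lemma index_3_cases:
  fixes i :: 3
  obtains j k where "i \<noteq> j" "i \<noteq> k" "j \<noteq> k" "UNIV = {i, j, k}"
proof -
  have "card (- {i}) = 2" by (rule card_Compl_singleton_3)
  then obtain j k where jk: "- {i} = {j, k}" "j \<noteq> k" by (auto simp: card_2_iff)
  have "UNIV = {i, j, k}" using jk by blast
  moreover have "i \<noteq> j" "i \<noteq> k" using jk by blast+
  ultimately show ?thesis using that jk by blast
qed

lemma a_num_Suc: "a_num (Suc n) \<le> a_num n + 3 * n + 1"
proof -
  obtain R where R: "rook_covering n R" "card R = a_num n"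
    using a_num_attained by blast
  define E :: "3 \<times> nat \<Rightarrow> rook" where "E = (\<lambda>(i, y). ((\<lambda>_. y)(i := n), - {i}))"
  define F where "F = E ` (UNIV \<times> {..<n})"
  define c :: rook where "c = ((\<lambda>_. n), - {0})"
  define R' where "R' = insert c (R \<union> F)"
  have finF: "finite F" by (simp add: F_def)
  have cardF: "card F \<le> 3 * n"
    unfolding F_def by (rule order_trans[OF card_image_le]) (auto simp: card_cartesian_product)
  have "card R' \<le> Suc (card (R \<union> F))"
    unfolding R'_def by (rule card_insert_le_m1[of _ _, simplified]) auto
  also have "card (R \<union> F) \<le> card R + card F" by (rule card_Un_le)
  finally have card: "card R' \<le> a_num n + 3 * n + 1" using cardF R(2) by simp
  have old: "P i < n" if "(P, D) \<in> R" for P D i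
    using that R(1) by (auto simp: rook_covering_def rooks_def cube_def)
  have inj_c: "fst r \<noteq> fst c" if "r \<in> R \<union> F" for r
  proof
    assume eq: "fst r = fst c"
    have all: "fst r i = n" for i using eq by (simp add: c_def)
    show False
    proof (cases "r \<in> R")
      case True
      then show False using old[of "fst r" "snd r" 0] all by simp
    next
      case False
      then obtain i y where iy: "y < n" "r = E (i, y)" using \<open>r \<in> R \<union> F\<close> by (auto simp: F_def)
      obtain j k where "i \<noteq> j" by (rule index_3_cases[of i]) blast
      then show False using all[of j] iy by (auto simp: E_def)
    qed
  qed
  have inj_RF: "fst r \<noteq> fst s" if "r \<in> R" "s \<in> F" for r s
  proof
    assume eq: "fst r = fst s"
    obtain i y where "s = E (i, y)" using \<open>s \<in> F\<close> by (auto simp: F_def)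
    then have "fst s i = n" by (simp add: E_def)
    then show False using old[of "fst r" "snd r" i] that(1) eq by (cases r) auto
  qed
  have inj_F: "inj_on fst F"
  proof (rule inj_onI)
    fix r s assume rs: "r \<in> F" "s \<in> F" "fst r = fst s"
    obtain i y where r: "y < n" "r = E (i, y)" using rs(1) by (auto simp: F_def)
    obtain i' y' where s: "y' < n" "s = E (i', y')" using rs(2) by (auto simp: F_def)
    have f: "((\<lambda>_. y)(i := n)) j = ((\<lambda>_. y')(i' := n)) j" for j
      using rs(3) r s by (simp add: E_def)
    have "i = i'" using f[of i] s(1) by (auto split: if_splits)
    moreover obtain j k where "i \<noteq> j" by (rule index_3_cases[of i]) blast
    ultimately have "y = y'" using f[of j] by simp
    then show "r = s" using r s \<open>i = i'\<close> by simp
  qed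
  have inj: "inj_on fst R'"
    unfolding inj_on_def
  proof (intro ballI impI)
    fix r s assume "r \<in> R'" "s \<in> R'" and eq: "fst r = fst s"
    then have "r = c \<or> r \<in> R \<or> r \<in> F" "s = c \<or> s \<in> R \<or> s \<in> F"
      by (auto simp: R'_def)
    moreover have "inj_on fst R" using R(1) by (simp add: rook_covering_def)
    ultimately show "r = s"
      using eq inj_c[of r] inj_c[of s] inj_RF[of r s] inj_RF[of s r] inj_F
      by (auto dest: inj_onD)
  qed
  have "cube n \<subseteq> cube (Suc n)" by (auto simp: cube_def less_Suc_eq)
  then have "R \<subseteq> rooks (Suc n)" using R(1) by (auto simp: rook_covering_def rooks_def)
  moreover have "F \<subseteq> rooks (Suc n)"
    by (auto simp: F_def E_def rooks_def cube_def card_Compl_singleton_3)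
  moreover have "c \<in> rooks (Suc n)"
    by (simp add: c_def rooks_def cube_def card_Compl_singleton_3)
  ultimately have sub: "R' \<subseteq> rooks (Suc n)" by (simp add: R'_def)
  have "rook_covering (Suc n) R'"
  proof (rule rook_coveringI[OF sub inj])
    fix Q assume Q: "Q \<in> cube (Suc n)"
    then have le: "Q i \<le> n" for i by (simp add: cube_def less_Suc_eq_le)
    show "\<exists>P D. (P, D) \<in> R' \<and> (Q = P \<or> (\<exists>i\<in>D. {j. Q j \<noteq> P j} = {i}))"
    proof (cases "Q \<in> cube n")
      case True
      from R(1) this obtain P D where "(P, D) \<in> R"
        "Q = P \<or> (\<exists>i\<in>D. {j. Q j \<noteq> P j} = {i})" by (rule rook_coveringD)
      then show ?thesis by (auto simp: R'_def)
    next
      case False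
      then obtain i where i: "Q i = n"
        using le by (auto simp: cube_def not_less intro: antisym)
      show ?thesis
      proof (cases "\<forall>j. Q j = n")
        case True
        then have "Q = (\<lambda>_. n)" by auto
        then show ?thesis by (auto simp: R'_def c_def)
      next
        case False
        then obtain j where j: "Q j \<noteq> n" by blast
        then have "j \<noteq> i" "Q j < n" using i le[of j] by auto
        obtain k where k: "k \<noteq> i" "k \<noteq> j" "UNIV = {i, j, k}"
        proof -
          obtain j' k' where "i \<noteq> j'" "i \<noteq> k'" "j' \<noteq> k'" and u: "UNIV = {i, j', k'}"
            by (rule index_3_cases[of i])
          moreover have "j = j' \<or> j = k'" using u \<open>j \<noteq> i\<close> by blast
          ultimately show ?thesis using that[of j'] that[of k'] by auto
        qed
        define P where "P = (\<lambda>_. Q j)(i := n)"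
        have "E (i, Q j) \<in> R'"
          unfolding R'_def F_def using \<open>Q j < n\<close> by blast
        then have mem: "(P, - {i}) \<in> R'" by (simp add: E_def P_def)
        have agree: "Q l = P l" if "l \<noteq> k" for l
        proof -
          have "l = i \<or> l = j" using k(3) that by blast
          then show ?thesis using i \<open>j \<noteq> i\<close> by (auto simp: P_def)
        qed
        have "Q = P \<or> {l. Q l \<noteq> P l} = {k}"
        proof (cases "Q k = P k")
          case True
          then have "Q = P" using agree by (metis ext)
          then show ?thesis ..
        next
          case False
          then have "{l. Q l \<noteq> P l} = {k}" using agree by auto
          then show ?thesis ..
        qed
        then show ?thesis using mem k(1) by blast
      qed
    qed
  qed
  from a_num_le[OF this] card show ?thesis by simp
qed

lemma a_num_mult:
  assumes "k > 0"
  shows "a_num (k * n) \<le> k ^ 2 * a_num n"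
proof -
  obtain R where R: "rook_covering n R" "card R = a_num n"
    using a_num_attained by blast
  define S where "S = {s \<in> cube k. k dvd (\<Sum>i\<in>UNIV. s i)}"
  have finS: "finite S" using finite_cube by (simp add: S_def)
  have S_ex: "\<exists>s\<in>S. \<forall>j. j \<noteq> i \<longrightarrow> s j = t j" if t: "t \<in> cube k" for t i
  proof -
    define T where "T = (\<Sum>j\<in>UNIV - {i}. t j)"
    define s where "s = t(i := (k - T mod k) mod k)"
    have "(\<Sum>j\<in>UNIV. s j) = s i + (\<Sum>j\<in>UNIV - {i}. s j)"
      by (rule sum.remove) auto
    also have "(\<Sum>j\<in>UNIV - {i}. s j) = T"
      unfolding T_def by (rule sum.cong) (auto simp: s_def)
    finally have "(\<Sum>j\<in>UNIV. s j) = (k - T mod k) mod k + T" by (simp add: s_def)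
    moreover have "((k - T mod k) mod k + T) mod k = 0"
    proof -
      have "((k - T mod k) mod k + T) mod k = ((k - T mod k) + T mod k) mod k"
        by (metis mod_add_left_eq mod_add_right_eq)
      also have "\<dots> = 0" using assms by (simp add: less_imp_le)
      finally show ?thesis .
    qed
    ultimately have "k dvd (\<Sum>j\<in>UNIV. s j)" by (simp add: mod_eq_0_iff_dvd)
    moreover have "s \<in> cube k" using t assms by (simp add: s_def cube_def)
    ultimately have "s \<in> S" by (simp add: S_def)
    then show ?thesis by (intro bexI[of _ s]) (auto simp: s_def)
  qed
  have cardS: "card S \<le> k ^ 2"
  proof -
    obtain j l where jl: "(0::3) \<noteq> j" "0 \<noteq> l" "j \<noteq> l" "UNIV = {0, j, l}"
      by (rule index_3_cases[of 0])
    have "inj_on (\<lambda>s. (s j, s l)) S"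
    proof (rule inj_onI)
      fix s t assume st: "s \<in> S" "t \<in> S" "(s j, s l) = (t j, t l)"
      have sum: "(\<Sum>i\<in>UNIV. u i) = u 0 + (u j + u l)" for u :: point
        unfolding jl(4) using jl(1-3) by simp
      have le: "u 0 \<le> v 0" if "u \<in> S" "v \<in> S" "u j + u l = v j + v l" for u v :: point
      proof (rule ccontr)
        assume less: "\<not> u 0 \<le> v 0"
        have "k dvd (u 0 + (u j + u l)) - (v 0 + (v j + v l))"
          using that(1,2) by (intro dvd_diff_nat) (auto simp: S_def sum)
        then have "k dvd u 0 - v 0" using that(3) by simp
        moreover have "u 0 < k" using that(1) by (simp add: S_def cube_def)
        ultimately show False using less by (auto dest: dvd_imp_le)
      qed
      have "s 0 = t 0" using le[of s t] le[of t s] st by simp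
      then have "s i = t i" for i using st(3) jl(4) by (cases "i = 0"; cases "i = j") auto
      then show "s = t" by (rule ext)
    qed
    then have "card S \<le> card ({..<k} \<times> {..<k})"
      by (rule card_inj_on_le) (auto simp: S_def cube_def)
    then show ?thesis by (simp add: power2_eq_square)
  qed
  define B :: "rook \<times> point \<Rightarrow> rook" where
    "B = (\<lambda>((P, D), s). ((\<lambda>i. k * P i + s i), D))"
  define R' where "R' = B ` (R \<times> S)"
  have finR: "finite R" by (rule rook_covering_finite[OF R(1)])
  have "card R' \<le> card (R \<times> S)"
    unfolding R'_def by (rule card_image_le) (simp add: finR finS)
  also have "\<dots> \<le> k ^ 2 * a_num n"
    using cardS R(2) by (simp add: card_cartesian_product)
  finally have card: "card R' \<le> k ^ 2 * a_num n" .
  have small: "s i < k" if "s \<in> S" for s i using that by (simp add: S_def cube_def)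
  have sub: "R' \<subseteq> rooks (k * n)"
  proof
    fix r assume "r \<in> R'"
    then obtain P D s where r: "(P, D) \<in> R" "s \<in> S" "r = ((\<lambda>i. k * P i + s i), D)"
      by (auto simp: R'_def B_def)
    have PD: "P i < n" "card D = 2" for i
      using r(1) R(1) by (auto simp: rook_covering_def rooks_def cube_def)
    have "k * P i + s i < k * n" for i
    proof -
      have "k * P i + s i < k * Suc (P i)" using small[OF r(2)] by simp
      also have "\<dots> \<le> k * n" using PD(1)[of i] by (intro mult_le_mono2) simp
      finally show ?thesis .
    qed
    then show "r \<in> rooks (k * n)" using r(3) PD(2) by (simp add: rooks_def cube_def)
  qed
  have inj: "inj_on fst R'"
  proof (rule inj_onI)
    fix r r' assume rr: "r \<in> R'" "r' \<in> R'" "fst r = fst r'"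
    obtain P D s where r: "(P, D) \<in> R" "s \<in> S" "r = ((\<lambda>i. k * P i + s i), D)"
      using rr(1) by (auto simp: R'_def B_def)
    obtain P' D' s' where r': "(P', D') \<in> R" "s' \<in> S" "r' = ((\<lambda>i. k * P' i + s' i), D')"
      using rr(2) by (auto simp: R'_def B_def)
    have eq: "k * P i + s i = k * P' i + s' i" for i
      using rr(3) r(3) r'(3) by (auto dest: fun_cong)
    have "P i = P' i" for i
    proof -
      have "(k * P i + s i) div k = P i" "(k * P' i + s' i) div k = P' i"
        using small[OF r(2), of i] small[OF r'(2), of i] assms by simp_all
      then show ?thesis using eq by simp
    qed
    then have "P = P'" by (rule ext)
    moreover have "inj_on fst R" using R(1) by (simp add: rook_covering_def)
    ultimately have "D = D'"
      using r(1) r'(1) inj_onD[of fst R "(P, D)" "(P', D')"] by simp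
    then show "r = r'" using rr(3) r(3) r'(3) by simp
  qed
  have "rook_covering (k * n) R'"
  proof (rule rook_coveringI[OF sub inj])
    fix Q assume Q: "Q \<in> cube (k * n)"
    define U where "U = (\<lambda>i. Q i div k)"
    define t where "t = (\<lambda>i. Q i mod k)"
    have "U \<in> cube n"
      using Q by (simp add: U_def cube_def less_mult_imp_div_less mult.commute)
    with R(1) obtain P D where PD: "(P, D) \<in> R" "card D = 2"
      "U = P \<or> (\<exists>i\<in>D. {j. U j \<noteq> P j} = {i})" by (rule rook_coveringD)
    have "\<exists>i\<in>D. \<forall>j. j \<noteq> i \<longrightarrow> U j = P j"
    proof (cases "U = P")
      case True
      have "D \<noteq> {}" using PD(2) by auto
      then show ?thesis using True by auto
    next
      case False
      then show ?thesis using PD(3) by blast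
    qed
    then obtain i where i: "i \<in> D" "\<And>j. j \<noteq> i \<Longrightarrow> U j = P j" by blast
    have "t \<in> cube k" using assms by (simp add: t_def cube_def)
    from S_ex[OF this, of i] obtain s where s: "s \<in> S" "\<And>j. j \<noteq> i \<Longrightarrow> s j = t j" by blast
    define V where "V = (\<lambda>i. k * P i + s i)"
    have "B ((P, D), s) \<in> R'" unfolding R'_def using PD(1) s(1) by blast
    then have mem: "(V, D) \<in> R'" by (simp add: B_def V_def)
    have agree: "Q j = V j" if "j \<noteq> i" for j
    proof -
      have "Q j = k * U j + t j" by (simp add: U_def t_def)
      then show ?thesis using i(2)[OF that] s(2)[OF that] by (simp add: V_def)
    qed
    have "Q = V \<or> {l. Q l \<noteq> V l} = {i}"
    proof (cases "Q i = V i")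
      case True
      then have "Q = V" using agree by (metis ext)
      then show ?thesis ..
    next
      case False
      then have "{l. Q l \<noteq> V l} = {i}" using agree by auto
      then show ?thesis ..
    qed
    then show "\<exists>P D. (P, D) \<in> R' \<and> (Q = P \<or> (\<exists>i\<in>D. {j. Q j \<noteq> P j} = {i}))"
      using mem i(1) by blast
  qed
  from a_num_le[OF this] card show ?thesis by simp
qed

lemma a_num_add: "a_num (m + r) \<le> a_num m + r * (3 * (m + r))"
proof (induction r)
  case (Suc r)
  have "a_num (m + Suc r) \<le> a_num (m + r) + 3 * (m + r) + 1"
    using a_num_Suc[of "m + r"] by simp
  also have "\<dots> \<le> a_num m + r * (3 * (m + r)) + 3 * (m + r) + 1" using Suc by simp
  also have "\<dots> \<le> a_num m + Suc r * (3 * (m + Suc r))" by (simp add: algebra_simps)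
  finally show ?case .
qed simp

lemma a_lim_tendsto: "(\<lambda>n. real (a_num n) / real n ^ 2) \<longlonglongrightarrow> a_lim"
proof -
  define b where "b = (\<lambda>n. real (a_num n) / real n ^ 2)"
  define L where "L = (INF n\<in>{0<..}. b n)"
  have bdd: "bdd_below (b ` {0<..})"
    by (rule bdd_belowI[of _ 0]) (auto simp: b_def)
  have L_le: "L \<le> b n" if "n > 0" for n
    unfolding L_def by (rule cINF_lower[OF bdd]) (use that in simp)
  have upper: "b N \<le> b n + 3 * real n / real N" if n: "n > 0" and N: "N \<ge> n" for n N
  proof -
    define k where "k = N div n"
    have k: "k > 0" using n N by (simp add: k_def div_greater_zero_iff)
    have Nk: "N = k * n + N mod n" by (simp add: k_def)
    have "a_num N \<le> a_num (k * n) + N mod n * (3 * N)"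
      using a_num_add[of "k * n" "N mod n"] Nk by simp
    also have "\<dots> \<le> k ^ 2 * a_num n + n * (3 * N)"
      using a_num_mult[OF k, of n] n by (intro add_mono mult_le_mono1) auto
    finally have "real (a_num N) \<le> real (k ^ 2 * a_num n + n * (3 * N))"
      by (rule of_nat_mono)
    also have "\<dots> = (real k * real n) ^ 2 * b n + 3 * real n * real N"
      using n by (simp add: b_def power_mult_distrib)
    also have "\<dots> \<le> real N ^ 2 * b n + 3 * real n * real N"
    proof -
      have "k * n \<le> N" by (simp add: k_def)
      then have "real k * real n \<le> real N" by (metis of_nat_le_iff of_nat_mult)
      then show ?thesis
        by (intro add_mono mult_right_mono power_mono) (auto simp: b_def)
    qed
    finally have "b N \<le> (real N ^ 2 * b n + 3 * real n * real N) / real N ^ 2"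
      unfolding b_def[THEN fun_cong, of N] by (rule divide_right_mono) simp
    also have "\<dots> = b n + 3 * real n / real N"
      using n N by (simp add: add_divide_distrib power2_eq_square)
    finally show ?thesis .
  qed
  have "b \<longlonglongrightarrow> L"
  proof (rule LIMSEQ_I)
    fix e :: real assume e: "e > 0"
    have "\<exists>n\<in>{0<..}. b n < L + e / 2"
      using e cINF_less_iff[OF _ bdd, of "L + e / 2"] by (simp add: L_def)
    then obtain n where n: "n > 0" "b n < L + e / 2" by auto
    obtain N0 where N0: "6 * real n / e < real N0" using reals_Archimedean2 by blast
    show "\<exists>no. \<forall>N\<ge>no. norm (b N - L) < e"
    proof (intro exI allI impI)
      fix N assume N: "N \<ge> max n N0"
      then have "N > 0" using n by simp
      have "6 * real n / e < real N" using N N0 by (simp add: order_less_le_trans)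
      then have "3 * real n / real N < e / 2"
        using e \<open>N > 0\<close> by (simp add: field_simps)
      then have "b N < L + e" using upper[OF n(1), of N] N n(2) by simp
      then show "norm (b N - L) < e" using L_le[OF \<open>N > 0\<close>] by simp
    qed
  qed
  then show ?thesis unfolding b_def a_lim_def by (simp add: limI)
qed

end

theory Submission
  imports Defs
begin

text \<open>
  Split \<open>X\<close>, \<open>Y\<close>, \<open>Z\<close> into two parts each, of sizes \<open>(a, b)\<close>, \<open>(b, a)\<close>, \<open>(c, c)\<close> with
  \<open>a + b = 2 c = n\<close>. Every point agrees in two coordinates with one of the blocks
  \<open>X\<^sub>0 \<times> Y\<^sub>0 \<times> Z\<^sub>0\<close> and \<open>X\<^sub>1 \<times> Y\<^sub>1 \<times> Z\<^sub>1\<close>, so it suffices that rooks inside the blocks cover all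
  axis-parallel lines meeting them. The first block meets \<open>a c\<close>, \<open>b c\<close> and \<open>a b\<close> lines in the
  three directions, and if \<open>a b + b c \<le> a c\<close> then \<open>a c\<close> rooks, one on each line in direction
  \<open>Y\<close>, suffice; the second block is the mirror image. This uses \<open>2 a c\<close> rooks, and the condition
  amounts to \<open>2 c\<^sup>2 \<le> a\<^sup>2\<close>, so \<open>a / n\<close> can be taken arbitrarily close to \<open>1 / \<surd>2\<close>.
\<close>

text \<open>
  \<open>f x z\<close> is the height of the rook on the line over \<open>(x, z)\<close>, and \<open>L x z\<close> says that its second
  direction is \<open>X\<close> rather than \<open>Z\<close>. With \<open>d = c - b\<close>, the set \<open>L\<close> consists of \<open>d\<close> cyclically
  consecutive cells in each row, each row starting where the previous one ends; row \<open>x\<close> thus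
  starts at \<open>x * d\<close>, which is \<open>- x * b\<close> modulo \<open>c\<close>.
\<close>
lemma line_filling_exists:
  fixes a b c :: nat
  assumes b: "0 < b" "b < c" and count: "b * c \<le> a * (c - b)"
  shows "\<exists>f L. (\<forall>x z. f x z < b) \<and>
    (\<forall>y<b. \<forall>z<c. \<exists>x<a. f x z = y \<and> L x z) \<and>
    (\<forall>x y. y < b \<longrightarrow> (\<exists>z<c. f x z = y \<and> \<not> L x z))"
proof -
  define d where "d = c - b"
  have d: "0 < d" "c = d + b" using b by (auto simp: d_def)
  define i where "i = (\<lambda>x z. (z + x * b) mod c)"
  define L where "L = (\<lambda>x z. i x z < d)"
  \<comment> \<open>The cells of \<open>L\<close> are numbered row by row by
    \<open>x * d + i x z\<close>, which is congruent to \<open>z\<close> modulo \<open>c\<close>; so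
    each run of \<open>c\<close> numbers meets every column once and shares one height. The
    \<open>min\<close> caps surplus cells, numbered from \<open>b * c\<close> on.\<close>
  define f where
    "f = (\<lambda>x z. if L x z then min (b - 1) ((x * d + i x z) div c) else i x z - d)"
  have i_less: "i x z < c" for x z using b by (simp add: i_def)
  have "f x z < b" for x z
    using i_less[of x z] b d by (auto simp: f_def L_def)
  moreover have "\<exists>x<a. f x z = y \<and> L x z" if "y < b" "z < c" for y z
  proof (intro exI conjI)
    \<comment> \<open>The row containing the cell numbered \<open>z + y * c\<close>.\<close>
    define x where "x = (z + y * c) div d"
    define r where "r = (z + y * c) mod d"
    have eq: "x * d + r = z + y * c" by (simp add: x_def r_def)
    have "z + y * c < Suc y * c" using that by simp
    also have "\<dots> \<le> b * c" using that by (intro mult_le_mono1) simp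
    also have "\<dots> \<le> a * d" using count by (simp add: d_def)
    finally show "x < a" by (simp add: x_def less_mult_imp_div_less)
    have "r < d" using d by (simp add: r_def)
    have "z + x * b + y * c = r + x * c" using eq by (simp add: d(2) algebra_simps)
    then have "(z + x * b) mod c = r mod c" by (metis mod_mult_self1)
    then have i: "i x z = r" using \<open>r < d\<close> d by (simp add: i_def)
    then show "L x z" using \<open>r < d\<close> by (simp add: L_def)
    then show "f x z = y" using i eq that by (simp add: f_def)
  qed
  moreover have "\<exists>z<c. f x z = y \<and> \<not> L x z" if "y < b" for x y
  proof (intro exI conjI)
    \<comment> \<open>The column at position \<open>d + y\<close> of row \<open>x\<close>, just past
      its \<open>L\<close> cells.\<close>
    define z where "z = (d + y + x * d) mod c"
    show "z < c" using b by (simp add: z_def)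
    have "i x z = (d + y + x * d + x * b) mod c" by (simp add: i_def z_def mod_simps)
    also have "d + y + x * d + x * b = d + y + x * c" by (simp add: d(2) algebra_simps)
    finally have i: "i x z = d + y" using that d by simp
    then show "\<not> L x z" by (simp add: L_def)
    then show "f x z = y" using i by (simp add: f_def)
  qed
  ultimately show ?thesis by blast
qed

definition point3 :: "nat \<Rightarrow> nat \<Rightarrow> nat \<Rightarrow> point" where
  "point3 x y z = (\<lambda>i. if i = 0 then x else if i = 1 then y else z)"

lemma point3_simps [simp]:
  "point3 x y z 0 = x" "point3 x y z 1 = y" "point3 x y z 2 = z"
  by (simp_all add: point3_def)

lemma all_3: "(\<forall>i::3. P i) \<longleftrightarrow> P 0 \<and> P 1 \<and> P 2"
proof -
  have "(3::3) = 0" by simp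
  then show ?thesis using forall_3[of P] by metis
qed

lemma point3_eq_iff: "point3 x y z = point3 x' y' z' \<longleftrightarrow> x = x' \<and> y = y' \<and> z = z'"
  by (auto simp: fun_eq_iff all_3)

lemma point3_eta: "point3 (Q 0) (Q 1) (Q 2) = Q"
  by (simp add: fun_eq_iff all_3)

lemma point3_in_cube_iff: "point3 x y z \<in> cube n \<longleftrightarrow> x < n \<and> y < n \<and> z < n"
  by (simp add: cube_def all_3)

lemma differ_at_most_oneI:
  assumes "\<And>j. j \<noteq> i \<Longrightarrow> Q j = P j" "i \<in> D"
  shows "Q = P \<or> (\<exists>i\<in>D. {j. Q j \<noteq> P j} = {i})"
proof (cases "Q i = P i")
  case True
  then have "Q = P" using assms(1) by (metis ext)
  then show ?thesis ..
next
  case False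
  then have "{j. Q j \<noteq> P j} = {i}" using assms(1) by auto
  then show ?thesis using assms(2) by blast
qed

lemma a_num_double_le:
  assumes b: "0 < b" "b < c" and count: "b * c \<le> (2 * c - b) * (c - b)"
  shows "a_num (2 * c) \<le> 2 * ((2 * c - b) * c)"
proof -
  define a where "a = 2 * c - b"
  have n: "2 * c = a + b" using b by (simp add: a_def)
  obtain f L where f: "\<And>x z. f x z < b"
    and L: "\<And>y z. \<lbrakk>y < b; z < c\<rbrakk> \<Longrightarrow> \<exists>x<a. f x z = y \<and> L x z"
    and nL: "\<And>x y. y < b \<Longrightarrow> \<exists>z<c. f x z = y \<and> \<not> L x z"
    using line_filling_exists[OF b count[folded a_def]] by blast
  define G :: "nat \<times> nat \<Rightarrow> rook" where
    "G = (\<lambda>(x, z). (point3 x (f x z) z, if L x z then {0, 1} else {1, 2}))"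
  \<comment> \<open>\<open>G\<close> with directions 0 and 1 interchanged, shifted to the opposite
    block.\<close>
  define H :: "nat \<times> nat \<Rightarrow> rook" where
    "H = (\<lambda>(y, z). (point3 (a + f y z) (b + y) (c + z), if L y z then {0, 1} else {0, 2}))"
  define S where "S = {..<a} \<times> {..<c}"
  define R where "R = G ` S \<union> H ` S"
  have "card R \<le> card (G ` S) + card (H ` S)" unfolding R_def by (rule card_Un_le)
  also have "\<dots> \<le> card S + card S"
    by (intro add_mono card_image_le) (simp_all add: S_def)
  also have "\<dots> = 2 * (a * c)" by (simp add: S_def)
  finally have card: "card R \<le> 2 * (a * c)" .
  have sub: "R \<subseteq> rooks (2 * c)"
  proof -
    have "G (x, z) \<in> rooks (2 * c)" if "x < a" "z < c" for x z
      using that f[of x z] b n by (auto simp: G_def rooks_def point3_in_cube_iff)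
    moreover have "H (y, z) \<in> rooks (2 * c)" if "y < a" "z < c" for y z
      using that f[of y z] b n by (auto simp: H_def rooks_def point3_in_cube_iff)
    ultimately show ?thesis by (auto simp: R_def S_def)
  qed
  have inj: "inj_on fst R"
    by (rule inj_onI) (auto simp: R_def S_def G_def H_def point3_eq_iff)
  have "rook_covering (2 * c) R"
  proof (rule rook_coveringI[OF sub inj])
    fix Q assume "Q \<in> cube (2 * c)"
    moreover define x y z where "x = Q 0" and "y = Q 1" and "z = Q 2"
    ultimately have less: "x < a + b" "y < a + b" "z < c + c"
      by (auto simp: cube_def simp flip: n mult_2)
    have Q: "Q = point3 x y z" by (simp add: x_def y_def z_def point3_eta)
    have coverI: "\<exists>P D. (P, D) \<in> R \<and> (Q = P \<or> (\<exists>i\<in>D. {j. Q j \<noteq> P j} = {i}))"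
      if "r \<in> R" "r = (P, D)" "i \<in> D" "\<forall>j. j \<noteq> i \<longrightarrow> Q j = P j" for r P D i
      using that differ_at_most_oneI[of i Q P D] by blast
    have G: "G (x', z') \<in> R" if "x' < a" "z' < c" for x' z'
      using that by (auto simp: R_def S_def)
    have H: "H (y', z') \<in> R" if "y' < a" "z' < c" for y' z'
      using that by (auto simp: R_def S_def)
    \<comment> \<open>Pigeonhole: two coordinates fall in the same block, and the covering rook
      moves along the third.\<close>
    consider "x < a" "y < b" | "x < a" "z < c" | "y < b" "z < c"
      | "a \<le> x" "b \<le> y" | "a \<le> x" "c \<le> z" | "b \<le> y" "c \<le> z" by linarith
    then show "\<exists>P D. (P, D) \<in> R \<and> (Q = P \<or> (\<exists>i\<in>D. {j. Q j \<noteq> P j} = {i}))"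
    proof cases
      case 1
      then obtain z' where "z' < c" "f x z' = y" "\<not> L x z'" using nL by blast
      then show ?thesis
        by (intro coverI[OF G[of x z'], of _ _ 2]) (use 1 in \<open>auto simp: G_def Q all_3\<close>)
    next
      case 2
      then show ?thesis
        by (intro coverI[OF G[of x z], of _ _ 1]) (auto simp: G_def Q all_3)
    next
      case 3
      then obtain x' where "x' < a" "f x' z = y" "L x' z" using L by blast
      then show ?thesis
        by (intro coverI[OF G[of x' z], of _ _ 0]) (use 3 in \<open>auto simp: G_def Q all_3\<close>)
    next
      case 4
      then have "x - a < b" "y - b < a" using less by auto
      then obtain z' where "z' < c" "f (y - b) z' = x - a" "\<not> L (y - b) z'" using nL by blast
      then show ?thesis
        by (intro coverI[OF H[of "y - b" z'], of _ _ 2])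
          (use 4 \<open>y - b < a\<close> in \<open>auto simp: H_def Q all_3\<close>)
    next
      case 5
      then have "x - a < b" "z - c < c" using less by auto
      then obtain y' where "y' < a" "f y' (z - c) = x - a" "L y' (z - c)" using L by blast
      then show ?thesis
        by (intro coverI[OF H[of y' "z - c"], of _ _ 1])
          (use 5 \<open>z - c < c\<close> in \<open>auto simp: H_def Q all_3\<close>)
    next
      case 6
      then have "y - b < a" "z - c < c" using less by auto
      then show ?thesis
        by (intro coverI[OF H[of "y - b" "z - c"], of _ _ 0])
          (use 6 in \<open>auto simp: H_def Q all_3\<close>)
    qed
  qed
  from a_num_le[OF this] card show ?thesis by (simp add: a_def)
qed

lemma a_num_double_ratio_le:
  assumes k: "k \<ge> 2"
  shows "real (a_num (2 * k)) / real (2 * k) ^ 2 \<le> 1 / sqrt 2 + 1 / real k"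
proof -
  \<comment> \<open>The largest \<open>b\<close> with \<open>2 * k - b\<close> at least
    \<open>sqrt 2 * k\<close>; rounding costs less than 1.\<close>
  define b where "b = nat \<lfloor>(2 - sqrt 2) * real k\<rfloor>"
  have sqrt2: "sqrt 2 < 3 / 2" by (rule real_less_lsqrt) (simp_all add: power2_eq_square)
  have "1 \<le> (2 - sqrt 2) * 2" using sqrt2 by simp
  also have "\<dots> \<le> (2 - sqrt 2) * real k" using k sqrt2 by (intro mult_left_mono) auto
  finally have ge1: "1 \<le> (2 - sqrt 2) * real k" .
  then have "0 < b" by (simp add: b_def)
  have b_le: "real b \<le> (2 - sqrt 2) * real k" using ge1 by (simp add: b_def)
  have b_gt: "(2 - sqrt 2) * real k < real b + 1" using ge1 unfolding b_def by linarith
  have "(2 - sqrt 2) * real k < 1 * real k"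
    using k sqrt2 by (intro mult_strict_right_mono) auto
  then have "b < k" using b_le by linarith
  have a: "real (2 * k - b) = 2 * real k - real b" using \<open>b < k\<close> by (simp add: of_nat_diff)
  \<comment> \<open>Expanded, this is the counting condition: both say 4bk \<le> 2k^2 + b^2.\<close>
  have "(sqrt 2 * real k) ^ 2 \<le> (2 * real k - real b) ^ 2"
    using b_le by (intro power_mono) (auto simp: algebra_simps)
  then have "real b * real k \<le> (2 * real k - real b) * (real k - real b)"
    by (simp add: power_mult_distrib) (simp add: power2_eq_square algebra_simps)
  also have "\<dots> = real ((2 * k - b) * (k - b))" using \<open>b < k\<close> a by (simp add: of_nat_diff)
  finally have "b * k \<le> (2 * k - b) * (k - b)" by (metis of_nat_le_iff of_nat_mult)
  from a_num_double_le[OF \<open>0 < b\<close> \<open>b < k\<close> this]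
  have "real (a_num (2 * k)) \<le> real (2 * ((2 * k - b) * k))" by (rule of_nat_mono)
  also have "\<dots> = 2 * (2 * real k - real b) * real k" using a by simp
  also have "\<dots> \<le> 2 * (sqrt 2 * real k + 1) * real k"
    using b_gt by (intro mult_right_mono) (auto simp: algebra_simps)
  finally have "real (a_num (2 * k)) / real (2 * k) ^ 2
      \<le> 2 * (sqrt 2 * real k + 1) * real k / real (2 * k) ^ 2"
    by (rule divide_right_mono) simp
  also have "\<dots> = sqrt 2 / 2 + 1 / (2 * real k)"
    using k by (simp add: field_simps power2_eq_square)
  also have "sqrt 2 / 2 = 1 / sqrt 2" by (simp add: field_simps)
  also have "1 / (2 * real k) \<le> 1 / real k" using k by (simp add: field_simps)
  finally show ?thesis by simp
qed

theorem theorem13: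
  shows "a_lim \<le> 1 / sqrt 2"
proof (rule LIMSEQ_le)
  \<comment> \<open>Even sizes suffice, as the full sequence converges.\<close>
  have "strict_mono (\<lambda>k::nat. 2 * k)" by (simp add: strict_mono_def)
  from LIMSEQ_subseq_LIMSEQ[OF a_lim_tendsto this]
  show "(\<lambda>k. real (a_num (2 * k)) / real (2 * k) ^ 2) \<longlonglongrightarrow> a_lim"
    by (simp add: comp_def)
  show "(\<lambda>k. 1 / sqrt 2 + 1 / real k) \<longlonglongrightarrow> 1 / sqrt 2"
    using tendsto_add[OF tendsto_const lim_1_over_n, of "1 / sqrt 2"] by simp
  show "\<exists>N. \<forall>k\<ge>N. real (a_num (2 * k)) / real (2 * k) ^ 2 \<le> 1 / sqrt 2 + 1 / real k"
    using a_num_double_ratio_le by blast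
qed

end
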